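(* For $(A,B,C,D)=(0,1,0,1)$, the series $\tan_q(z)=\tan_q^{(0,1,0,1)}(z)$ has the continued fraction expansion $$\tan_q(z)=\cfrac{z}{[1]_qq^{-0}-\cfrac{z^2}{[3]_qq^{-2}-\cfrac{z^2}{[5]_qq^{-2}-\cfrac{z^2}{[7]_qq^{-4}-\cfrac{z^2}{\ddots}}}}}$$ where the negative powers of $q$ go like $0,2,2,4,4,6,6,8,8,\dots$, i.e. the $k$-th partial denominator ($k\ge1$) is $[2k-1]_q\,q^{-2\lfloor k/2\rfloor}$.
   Context: Let $0<q<1$, $[n]_q=\frac{1-q^n}{1-q}$, $[n]_q!=[1]_q[2]_q\cdots[n]_q$, $[0]_q!=1$. For a vector of exponents $(A,B,C,D)$ define the power series in $z$ $$\sin_q(z)=\sum_{n\ge0}\frac{(-1)^nz^{2n+1}}{[2n+1]_q!}q^{An^2+Bn},\qquad \cos_q(z)=\sum_{n\ge0}\frac{(-1)^nz^{2n}}{[2n]_q!}q^{Cn^2+Dn},$$ and $\tan_q^{(A,B,C,D)}(z)=\sin_q(z)/\cos_q(z)$. The continued fraction is understood as an identity of formal power series in $z$: the finite truncations (convergents), which are rational functions of $z$ expanded at $z=0$, converge coefficientwise to $\tan_q(z)$. *)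

theory Defs
  imports "HOL-Computational_Algebra.Formal_Power_Series" Complex_Main
begin

definition q_bracket :: "real \<Rightarrow> nat \<Rightarrow> real" where
  "q_bracket q n = (1 - q ^ n) / (1 - q)"

definition q_fact :: "real \<Rightarrow> nat \<Rightarrow> real" where
  "q_fact q n = (\<Prod>k=1..n. q_bracket q k)"

(* The exponents A, B, C, D are arbitrary reals, hence powr. In the coefficient of z ^ m the
   summation index of the defining series is n = m div 2. *)

definition q_sin :: "real \<Rightarrow> real \<Rightarrow> real \<Rightarrow> real fps" where
  "q_sin A B q = Abs_fps (\<lambda>m. if odd m
     then (let n = m div 2 in
       (-1) ^ n / q_fact q (2 * n + 1) * q powr (A * (real n)\<^sup>2 + B * real n))
     else 0)"

definition q_cos :: "real \<Rightarrow> real \<Rightarrow> real \<Rightarrow> real fps" where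
  "q_cos C D q = Abs_fps (\<lambda>m. if even m
     then (let n = m div 2 in
       (-1) ^ n / q_fact q (2 * n) * q powr (C * (real n)\<^sup>2 + D * real n))
     else 0)"

(* q_cos has constant coefficient 1, so this is a quotient by a unit. *)
definition q_tan :: "real \<Rightarrow> real \<Rightarrow> real \<Rightarrow> real \<Rightarrow> real \<Rightarrow> real fps" where
  "q_tan A B C D q = q_sin A B q / q_cos C D q"

(* cfrac_trunc a b k n is the finite continued fraction
     a k / (b k - a (k+1) / (b (k+1) - ... - a (k+n-1) / b (k+n-1)))
   with n partial quotients. It is evaluated directly in the ring of formal power series; if all
   a i have zero constant coefficient and all b i nonzero constant coefficient, then every
   denominator is a unit, and the result is the expansion at 0 of the corresponding
   rational function. *)
fun cfrac_trunc :: "(nat \<Rightarrow> real fps) \<Rightarrow> (nat \<Rightarrow> real fps) \<Rightarrow> nat \<Rightarrow> nat \<Rightarrow> real fps" where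
  "cfrac_trunc a b k 0 = 0"
| "cfrac_trunc a b k (Suc n) = a k / (b k - cfrac_trunc a b (Suc k) n)"

end

theory Submission
  imports Defs
begin

text \<open>Split the \<open>q\<close>-factorial into \<open>E\<^sub>n = [2]\<^sub>q [4]\<^sub>q \<dots> [2n]\<^sub>q\<close> and
  \<open>O\<^sub>n = [1]\<^sub>q [3]\<^sub>q \<dots> [2n-1]\<^sub>q\<close>, so that \<open>[2n]\<^sub>q! = E\<^sub>n O\<^sub>n\<close> and
  \<open>[2n+1]\<^sub>q! = E\<^sub>n O\<^sub>n\<^sub>+\<^sub>1\<close>. Then cosine and \<open>z\<^sup>-\<^sup>1\<close> times sine are the first two
  members \<open>S\<^sub>0, S\<^sub>1\<close> of the family
  \<open>S\<^sub>k = \<Sum>\<^sub>n (-1)\<^sup>n q\<^sup>n\<^sup>+\<^sup>e\<^sup>(\<^sup>k\<^sup>) z\<^sup>2\<^sup>n / (E\<^sub>n O\<^sub>n\<^sub>+\<^sub>k)\<close>, which satisfies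
  \<open>S\<^sub>k\<^sub>-\<^sub>1 = b\<^sub>k S\<^sub>k - z\<^sup>2 S\<^sub>k\<^sub>+\<^sub>1\<close> for the partial denominators \<open>b\<^sub>k\<close> of the continued fraction as soon
  as \<open>e(0) = 0\<close> and \<open>e(k) - e(k-1) = 2\<lfloor>k/2\<rfloor>\<close>. So the quotients \<open>z\<^sup>2 S\<^sub>k / S\<^sub>k\<^sub>-\<^sub>1\<close> are the tails of the continued
  fraction, and each further partial quotient makes at least one more coefficient correct.\<close>

unbundle fps_syntax

section \<open>Convergence of truncated continued fractions\<close>

lemma fps_X_dvd_iff: "fps_X dvd (f :: 'a :: field fps) \<longleftrightarrow> f $ 0 = 0"
proof
  assume "f $ 0 = 0"
  then have "f = fps_X * fps_shift 1 f"
    by (intro fps_ext) (simp add: fps_X_mult_nth)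
  then show "fps_X dvd f" by (rule dvdI)
qed (auto elim: dvdE)

text \<open>Replacing the tail \<open>t (Suc k)\<close> by an approximation \<open>T\<close> changes
  \<open>a k / (b k - t (Suc k))\<close> by \<open>a k * (T - t (Suc k)) / (u * v)\<close> with
  units \<open>u\<close>, \<open>v\<close>. Since \<open>fps_X\<close> divides \<open>a k\<close>,
  each level gains one order of accuracy.\<close>

lemma cfrac_trunc_approx:
  fixes a b t :: "nat \<Rightarrow> real fps"
  assumes a: "\<And>j. j \<ge> k \<Longrightarrow> a j $ 0 = 0" and b: "\<And>j. j \<ge> k \<Longrightarrow> b j $ 0 \<noteq> 0"
    and t: "\<And>j. j \<ge> k \<Longrightarrow> t j * (b j - t (Suc j)) = a j"
    and t0: "\<And>j. j \<ge> k \<Longrightarrow> t j $ 0 = 0"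
  shows "fps_X ^ Suc n dvd cfrac_trunc a b k n - t k"
  using assms
proof (induction n arbitrary: k)
  case 0
  have "fps_X dvd t k"
    using "0.prems"(4)[of k] by (simp add: fps_X_dvd_iff)
  then show ?case by simp
next
  case (Suc n)
  define T where "T = cfrac_trunc a b (Suc k) n"
  define u where "u = b k - T"
  define v where "v = b k - t (Suc k)"
  have IH: "fps_X ^ Suc n dvd T - t (Suc k)"
    unfolding T_def by (rule Suc.IH) (use Suc.prems in auto)
  have "fps_X dvd T - t (Suc k)"
    using IH by (metis dvd_mult_left power_Suc)
  then have "T $ 0 = t (Suc k) $ 0" by (simp add: fps_X_dvd_iff)
  with Suc.prems(4)[of "Suc k"] have "T $ 0 = 0" by simp
  with Suc.prems(2)[of k] Suc.prems(4)[of "Suc k"] have uv: "is_unit u" "is_unit v"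
    by (simp_all add: u_def v_def)
  have X: "fps_X dvd a k"
    using Suc.prems(1)[of k] by (simp add: fps_X_dvd_iff)
  have Tu: "a k / u * u = a k"
    using uv(1) by (simp add: dvd_div_mult_self unit_imp_dvd)
  have "(a k / u - t k) * (u * v) = (a k / u * u) * v - (t k * v) * u"
    by (simp add: algebra_simps)
  also have "\<dots> = a k * (T - t (Suc k))"
    using Suc.prems(3)[of k] unfolding Tu by (simp add: u_def v_def algebra_simps)
  finally have "fps_X ^ Suc (Suc n) dvd (a k / u - t k) * (u * v)"
    using mult_dvd_mono[OF X IH] by simp
  moreover have "is_unit (u * v)" using uv by simp
  ultimately have "fps_X ^ Suc (Suc n) dvd a k / u - t k"
    using dvd_mult_unit_iff by blast
  then show ?case by (simp add: u_def T_def)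
qed

corollary cfrac_trunc_tendsto:
  fixes a b t :: "nat \<Rightarrow> real fps"
  assumes "\<And>j. j \<ge> k \<Longrightarrow> a j $ 0 = 0" "\<And>j. j \<ge> k \<Longrightarrow> b j $ 0 \<noteq> 0"
    and "\<And>j. j \<ge> k \<Longrightarrow> t j * (b j - t (Suc j)) = a j"
    and "\<And>j. j \<ge> k \<Longrightarrow> t j $ 0 = 0"
  shows "(\<lambda>n. cfrac_trunc a b k n) \<longlonglongrightarrow> t k"
proof (rule tendsto_fpsI)
  fix m
  have "cfrac_trunc a b k n $ m = t k $ m" if "n \<ge> m" for n
  proof -
    have "fps_X ^ Suc n dvd cfrac_trunc a b k n - t k"
      using assms by (rule cfrac_trunc_approx)
    then obtain g where "cfrac_trunc a b k n - t k = fps_X ^ Suc n * g" ..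
    then have "(cfrac_trunc a b k n - t k) $ m = (fps_X ^ Suc n * g) $ m" by simp
    also have "\<dots> = 0" using that by (subst fps_X_power_mult_nth) simp
    finally show ?thesis by simp
  qed
  then show "\<forall>\<^sub>F n in sequentially. cfrac_trunc a b k n $ m = t k $ m"
    by (auto simp: eventually_sequentially)
qed

section \<open>Factorials split by parity, and the tail series\<close>

definition even_fact :: "real \<Rightarrow> nat \<Rightarrow> real" where
  "even_fact q n = (\<Prod>i<n. q_bracket q (2 * i + 2))"

definition odd_fact :: "real \<Rightarrow> nat \<Rightarrow> real" where
  "odd_fact q n = (\<Prod>i<n. q_bracket q (2 * i + 1))"

definition tail_expo :: "nat \<Rightarrow> nat" where
  "tail_expo k = (\<Sum>j\<le>k. 2 * (j div 2))"

definition tail_coeff :: "real \<Rightarrow> nat \<Rightarrow> nat \<Rightarrow> real" where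
  "tail_coeff q k n = (-1) ^ n * q ^ (n + tail_expo k) / (even_fact q n * odd_fact q (n + k))"

definition tail_series :: "real \<Rightarrow> nat \<Rightarrow> real fps" where
  "tail_series q k = Abs_fps (\<lambda>m. if even m then tail_coeff q k (m div 2) else 0)"

lemma even_fact_Suc: "even_fact q (Suc n) = even_fact q n * q_bracket q (2 * n + 2)"
  by (simp add: even_fact_def)

lemma odd_fact_Suc: "odd_fact q (Suc n) = odd_fact q n * q_bracket q (2 * n + 1)"
  by (simp add: odd_fact_def)

lemma q_fact_Suc: "q_fact q (Suc n) = q_fact q n * q_bracket q (Suc n)"
  by (simp add: q_fact_def)

lemma q_fact_even: "q_fact q (2 * n) = even_fact q n * odd_fact q n"
proof (induction n)
  case 0
  then show ?case by (simp add: q_fact_def even_fact_def odd_fact_def)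
next
  case (Suc n)
  then show ?case by (simp add: q_fact_Suc even_fact_Suc odd_fact_Suc)
qed

lemma q_fact_odd: "q_fact q (2 * n + 1) = even_fact q n * odd_fact q (Suc n)"
  using q_fact_even[of q n] by (simp add: q_fact_Suc odd_fact_Suc)

lemma tail_expo_Suc: "tail_expo (Suc k) = tail_expo k + 2 * (Suc k div 2)"
  by (simp add: tail_expo_def)

lemma tail_expo_Suc_Suc: "tail_expo (Suc (Suc k)) = tail_expo k + 2 * (k + 1)"
  unfolding tail_expo_Suc by presburger

section \<open>Recurrence of the tail series\<close>

context
  fixes q :: real
  assumes q: "0 < q" "q < 1"
begin

lemma q_bracket_pos: "n > 0 \<Longrightarrow> q_bracket q n > 0"
  using q by (simp add: q_bracket_def power_less_one_iff)

lemma even_fact_pos: "even_fact q n > 0"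
  by (auto simp: even_fact_def intro!: prod_pos q_bracket_pos)

lemma odd_fact_pos: "odd_fact q n > 0"
  by (auto simp: odd_fact_def intro!: prod_pos q_bracket_pos)

lemma q_bracket_add: "q_bracket q (m + n) = q_bracket q m + q ^ m * q_bracket q n"
  using q by (simp add: q_bracket_def field_simps power_add)

text \<open>The negative power of \<open>q\<close> cancels the growth of \<open>tail_expo\<close>
  from \<open>k\<close> to \<open>Suc k\<close>. Over a common denominator only
  \<open>[2k+1] - [2(n+k)+1] = -q^(2k+1) [2n]\<close> remains: it vanishes for \<open>n = 0\<close>,
  and otherwise \<open>[2n]\<close> cancels the last factor of \<open>even_fact q n\<close>.\<close>

lemma tail_coeff_diff:
  "q_bracket q (2 * k + 1) * q powi (- int (2 * (Suc k div 2))) * tail_coeff q (Suc k) n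
     - tail_coeff q k n
   = - ((-1) ^ n * q ^ (n + tail_expo k + (2 * k + 1)) * q_bracket q (2 * n)
        / (even_fact q n * odd_fact q (Suc (n + k))))"
proof -
  define e where "e = 2 * (Suc k div 2)"
  have qe: "q powi (- int e) * q ^ (n + tail_expo (Suc k)) = q ^ (n + tail_expo k)"
    using q by (simp add: tail_expo_Suc e_def power_add power_int_minus field_simps power_int_def
        del: of_nat_mult)
  have B: "q_bracket q (2 * (n + k) + 1)
           = q_bracket q (2 * k + 1) + q ^ (2 * k + 1) * q_bracket q (2 * n)"
    using q_bracket_add[of "2 * k + 1" "2 * n"] by (simp add: algebra_simps)
  have pos: "even_fact q n \<noteq> 0" "odd_fact q (n + k) \<noteq> 0" "q_bracket q (2 * (n + k) + 1) \<noteq> 0"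
    using even_fact_pos[of n] odd_fact_pos[of "n + k"] q_bracket_pos[of "2 * (n + k) + 1"]
    by auto
  define d where "d = even_fact q n * odd_fact q (Suc (n + k))"
  have d: "d \<noteq> 0" "d = even_fact q n * odd_fact q (n + k) * q_bracket q (2 * (n + k) + 1)"
    using pos by (simp_all add: d_def odd_fact_Suc)
  have "q_bracket q (2 * k + 1) * q powi (- int e) * tail_coeff q (Suc k) n
      = (-1) ^ n * q_bracket q (2 * k + 1) * (q powi (- int e) * q ^ (n + tail_expo (Suc k))) / d"
    by (simp add: tail_coeff_def d_def)
  also have "\<dots> = (-1) ^ n * q ^ (n + tail_expo k) * q_bracket q (2 * k + 1) / d"
    unfolding qe by simp
  finally have 1: "q_bracket q (2 * k + 1) * q powi (- int e) * tail_coeff q (Suc k) n = \<dots>" .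
  have 2: "tail_coeff q k n
      = (-1) ^ n * q ^ (n + tail_expo k) * q_bracket q (2 * (n + k) + 1) / d"
    using pos unfolding d(2) tail_coeff_def by simp
  show ?thesis
    unfolding e_def[symmetric] 1 2 B d_def[symmetric]
    by (simp add: diff_divide_distrib[symmetric] algebra_simps power_add)
qed

lemma tail_coeff_rec_0:
  "q_bracket q (2 * k + 1) * q powi (- int (2 * (Suc k div 2))) * tail_coeff q (Suc k) 0
     = tail_coeff q k 0"
  using tail_coeff_diff[of k 0] by (simp add: q_bracket_def)

lemma tail_coeff_rec_Suc:
  "q_bracket q (2 * k + 1) * q powi (- int (2 * (Suc k div 2))) * tail_coeff q (Suc k) (Suc n)
     - tail_coeff q (Suc (Suc k)) n = tail_coeff q k (Suc n)"
proof -
  have "q_bracket q (2 * Suc n) \<noteq> 0" "even_fact q n \<noteq> 0" "odd_fact q (Suc (Suc n + k)) \<noteq> 0"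
    using even_fact_pos[of n] odd_fact_pos[of "Suc (Suc n + k)"] q_bracket_pos[of "2 * Suc n"]
    by auto
  \<comment> \<open>The powers of \<open>q\<close> agree because \<open>tail_expo\<close> grows by
    \<open>2 * (k + 1)\<close> over two steps, and
    \<open>n + 2 * (k + 1) = Suc n + (2 * k + 1)\<close>.\<close>
  then have "tail_coeff q (Suc (Suc k)) n
    = - ((-1) ^ Suc n * q ^ (Suc n + tail_expo k + (2 * k + 1)) * q_bracket q (2 * Suc n)
        / (even_fact q (Suc n) * odd_fact q (Suc (Suc n + k))))"
    by (simp add: tail_coeff_def tail_expo_Suc_Suc even_fact_Suc power_add)
  with tail_coeff_diff[of k "Suc n"] show ?thesis by linarith
qed

lemma tail_series_rec:
  "fps_const (q_bracket q (2 * k + 1) * q powi (- int (2 * (Suc k div 2)))) * tail_series q (Suc k)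
     - fps_X ^ 2 * tail_series q (Suc (Suc k)) = tail_series q k"
proof (rule fps_ext)
  fix m
  consider "odd m" | "m = 0" | n where "m = 2 * Suc n"
    by (metis evenE not0_implies_Suc mult_0_right)
  then show "(fps_const (q_bracket q (2 * k + 1) * q powi (- int (2 * (Suc k div 2))))
      * tail_series q (Suc k) - fps_X ^ 2 * tail_series q (Suc (Suc k))) $ m
      = tail_series q k $ m"
  proof cases
    case 1
    then show ?thesis by (auto simp: tail_series_def fps_X_power_mult_nth)
  next
    case 2
    then show ?thesis
      using tail_coeff_rec_0[of k] by (simp add: tail_series_def fps_X_power_mult_nth)
  next
    case (3 n)
    then show ?thesis
      using tail_coeff_rec_Suc[of k n] by (simp add: tail_series_def fps_X_power_mult_nth)
  qed
qed

lemma tail_series_nth_0: "tail_series q k $ 0 \<noteq> 0"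
  using q even_fact_pos[of 0] odd_fact_pos[of k] by (simp add: tail_series_def tail_coeff_def)

lemma q_cos_eq_tail_series: "q_cos 0 1 q = tail_series q 0"
  using q
  by (intro fps_ext) (simp add: q_cos_def tail_series_def tail_coeff_def tail_expo_def
      q_fact_even powr_realpow Let_def)

lemma q_sin_eq_tail_series: "q_sin 0 1 q = fps_X * tail_series q 1"
proof (rule fps_ext)
  fix m
  show "q_sin 0 1 q $ m = (fps_X * tail_series q 1) $ m"
  proof (cases "odd m")
    case True
    then obtain n where "m = 2 * n + 1" by (auto elim: oddE)
    then show ?thesis
      using q q_fact_odd[of q n]
      by (simp add: q_sin_def tail_series_def tail_coeff_def tail_expo_def powr_realpow Let_def)
  qed (auto simp: q_sin_def tail_series_def)
qed

end

theorem theorem8: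
  fixes q :: real
  assumes "0 < q" and "q < 1"
  shows "(\<lambda>n. cfrac_trunc
            (\<lambda>k. if k = 1 then fps_X else fps_X ^ 2)
            (\<lambda>k. fps_const (q_bracket q (2 * k - 1) * q powi (- int (2 * (k div 2)))))
            1 n)
         \<longlonglongrightarrow> q_tan 0 1 0 1 q"
proof -
  define a :: "nat \<Rightarrow> real fps" where "a = (\<lambda>k. if k = 1 then fps_X else fps_X ^ 2)"
  define b where "b = (\<lambda>k. fps_const (q_bracket q (2 * k - 1) * q powi (- int (2 * (k div 2)))))"
  define S where "S = tail_series q"
  \<comment> \<open>The factor \<open>a k\<close> makes \<open>t 1\<close> equal to
    \<open>fps_X * S 1 / S 0\<close>, which is sine over cosine; from \<open>k = 2\<close> on it
    supplies the square of \<open>fps_X\<close>.\<close>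
  define t where "t = (\<lambda>k. a k * S k / S (k - 1))"
  have unit: "is_unit (S k)" for k
    using tail_series_nth_0[OF assms] by (simp add: S_def)
  have tS: "t (Suc k) * S k = a (Suc k) * S (Suc k)" for k
    using unit[of k] by (simp add: t_def dvd_div_mult_self unit_imp_dvd)
  have rec: "b (Suc k) * S (Suc k) - fps_X ^ 2 * S (Suc (Suc k)) = S k" for k
    using tail_series_rec[OF assms, of k] by (simp add: b_def S_def)
  have "cfrac_trunc a b 1 \<longlonglongrightarrow> t 1"
  proof (rule cfrac_trunc_tendsto)
    fix j :: nat assume "j \<ge> 1"
    then obtain k where j: "j = Suc k" by (metis Suc_le_D One_nat_def)
    show a0: "a j $ 0 = 0" by (simp add: a_def)
    show "b j $ 0 \<noteq> 0"
      using assms q_bracket_pos[OF assms, of "2 * j - 1"] by (simp add: b_def j)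
    have "t j $ 0 * S k $ 0 = (t j * S k) $ 0" by simp
    also have "\<dots> = 0" using a0 by (simp add: j tS)
    finally show "t j $ 0 = 0" using unit[of k] by simp
    \<comment> \<open>Multiplying by \<open>S j\<close> clears the denominator of
      \<open>t (Suc j)\<close>, so that the recurrence applies; the nonzero factor
      \<open>S j\<close> is cancelled at the end.\<close>
    have "t j * (b j - t (Suc j)) * S j = t j * (b j * S j - t (Suc j) * S j)"
      by (simp add: algebra_simps)
    also have "\<dots> = t j * (b j * S j - fps_X ^ 2 * S (Suc j))"
      unfolding tS by (simp add: a_def j)
    also have "\<dots> = a j * S j"
      unfolding j rec tS ..
    finally show "t j * (b j - t (Suc j)) = a j"
      using tail_series_nth_0[OF assms, of j] by (auto simp: S_def)
  qed
  moreover have "t 1 = q_tan 0 1 0 1 q"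
    by (simp add: t_def a_def S_def q_tan_def q_cos_eq_tail_series[OF assms]
        q_sin_eq_tail_series[OF assms])
  ultimately show ?thesis by (simp add: a_def b_def)
qed

end
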